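(* Let $\varnothing\ne T\subset\mathbb{R}$ and let $(M,\|\cdot\|)$ be a reflexive Banach space over $\mathbb{K}=\mathbb{R}$ or $\mathbb{C}$ with separable dual $(M^*,\|\cdot\|)$. Suppose the sequence $\{f_j\}_{j=1}^\infty\subset M^T$ is such that (i) $\sup_{j\in\mathbb{N}}\|f_j(t_0)\|\le C_0$ for some $t_0\in T$ and $C_0\ge0$; (ii) $v(\varepsilon)\equiv\limsup_{j\to\infty}V_\varepsilon(f_j,T)<\infty$ for all $\varepsilon>0$. Then there are a subsequence of $\{f_j\}$, again denoted by $\{f_j\}$, and a function $f\in M^T$, satisfying $V_\varepsilon(f,T)\le v(\varepsilon)$ for all $\varepsilon>0$ (and, a fortiori, $f$ is bounded and regulated on $T$), such that $f_j(t)$ converges weakly to $f(t)$ in $M$ as $j\to\infty$ for all $t\in T$.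
   Context: $M^T$ is the set of all functions $f:T\to M$, and $M$ carries the metric $d(x,y)=\|x-y\|$. For $f,g\in M^T$ put $\|f-g\|_{\infty,T}=\sup_{t\in T}\|f(t)-g(t)\|$. The (Jordan) variation of $g\in M^T$ is $V(g,T)=\sup\sum_{i=1}^m\|g(t_i)-g(t_{i-1})\|\in[0,\infty]$, the supremum being over all $m\in\mathbb{N}$ and all $t_0\le t_1\le\dots\le t_m$ in $T$; $\mathrm{BV}(T;M)=\{g\in M^T:V(g,T)<\infty\}$. For $\varepsilon>0$, the $\varepsilon$-variation of $f\in M^T$ is $$V_\varepsilon(f,T)=\inf\{V(g,T):g\in\mathrm{BV}(T;M),\ \|f-g\|_{\infty,T}\le\varepsilon\}\in[0,\infty],\qquad \inf\varnothing=\infty.$$ A function $f\in M^T$ is bounded if $\sup_{s,t\in T}\|f(s)-f(t)\|<\infty$. It is regulated on $T$ if for each $\tau\in T$ with $T\cap(\tau-\delta,\tau)\ne\varnothing$ for all $\delta>0$ one has $\|f(s)-f(t)\|\to0$ as $T\ni s,t\to\tau-0$, and for each $\tau'\in T$ with $T\cap(\tau',\tau'+\delta)\ne\varnothing$ for all $\delta>0$ one has $\|f(s)-f(t)\|\to0$ as $T\ni s,t\to\tau'+0$. *)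

theory Defs
  imports "HOL-Analysis.Analysis"
begin

text \<open>
  The scalar field is a type of the following class: a normed field that is (isometrically
  isomorphic to) the real or the complex numbers.
\<close>

class real_or_complex = real_normed_field +
  assumes real_or_complex:
    "(\<exists>h :: 'a \<Rightarrow> real. bij h
        \<and> (\<forall>x y. h (x + y) = h x + h y) \<and> (\<forall>x y. h (x * y) = h x * h y)
        \<and> (\<forall>r x. h (r *\<^sub>R x) = r *\<^sub>R h x) \<and> (\<forall>x. norm (h x) = norm x))
     \<or> (\<exists>h :: 'a \<Rightarrow> complex. bij h
        \<and> (\<forall>x y. h (x + y) = h x + h y) \<and> (\<forall>x y. h (x * y) = h x * h y)
        \<and> (\<forall>r x. h (r *\<^sub>R x) = r *\<^sub>R h x) \<and> (\<forall>x. norm (h x) = norm x))"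

instance real :: real_or_complex
  by standard (rule disjI1, rule exI[of _ id], auto)

instance complex :: real_or_complex
  by standard (rule disjI2, rule exI[of _ id], auto)

text \<open>
  A \<open>'k\<close>-normed space is carried by a type of class \<open>real_normed_vector\<close>, whose built-in
  \<open>scaleR\<close> is the restriction of the \<open>'k\<close>-multiplication \<open>smul\<close> to real scalars.
  For \<open>'k = real\<close> this forces \<open>smul = scaleR\<close>.
\<close>

locale normed_space_over = vector_space smul
  for smul :: "'k::real_or_complex \<Rightarrow> 'a::real_normed_vector \<Rightarrow> 'a" +
  assumes norm_smul: "norm (smul c x) = norm c * norm x"
    and smul_of_real: "smul (of_real r) x = r *\<^sub>R x"

text \<open>
  The dual consists of the bounded real-linear maps into \<open>'k\<close> that are \<open>'k\<close>-homogeneous;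
  its norm is the operator norm inherited from \<open>'a \<Rightarrow>\<^sub>L 'k\<close>.
\<close>

definition dual_space ::
    "('k::real_or_complex \<Rightarrow> 'a::real_normed_vector \<Rightarrow> 'a) \<Rightarrow> ('a \<Rightarrow>\<^sub>L 'k) set" where
  "dual_space smul =
     {\<phi>. \<forall>c x. blinfun_apply \<phi> (smul c x) = c * blinfun_apply \<phi> x}"

text \<open>
  Elements of the bidual are represented by functions on \<open>'a \<Rightarrow>\<^sub>L 'k\<close>, of which only the
  values on \<open>dual_space smul\<close> matter. The map \<open>blinfun_mult_right c o\<^sub>L \<phi>\<close> is
  \<open>x \<mapsto> c * \<phi> x\<close>.
\<close>

definition bidual_functional ::
    "('k::real_or_complex \<Rightarrow> 'a::real_normed_vector \<Rightarrow> 'a) \<Rightarrow> (('a \<Rightarrow>\<^sub>L 'k) \<Rightarrow> 'k) \<Rightarrow> bool" where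
  "bidual_functional smul F \<longleftrightarrow>
     (\<forall>\<phi>\<in>dual_space smul. \<forall>\<psi>\<in>dual_space smul. F (\<phi> + \<psi>) = F \<phi> + F \<psi>)
     \<and> (\<forall>c. \<forall>\<phi>\<in>dual_space smul. F (blinfun_mult_right c o\<^sub>L \<phi>) = c * F \<phi>)
     \<and> (\<exists>B. \<forall>\<phi>\<in>dual_space smul. norm (F \<phi>) \<le> B * norm \<phi>)"

definition reflexive_space ::
    "('k::real_or_complex \<Rightarrow> 'a::real_normed_vector \<Rightarrow> 'a) \<Rightarrow> bool" where
  "reflexive_space smul \<longleftrightarrow>
     (\<forall>F. bidual_functional smul F \<longrightarrow>
        (\<exists>x. \<forall>\<phi>\<in>dual_space smul. F \<phi> = blinfun_apply \<phi> x))"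

definition weakly_tendsto ::
    "('k::real_or_complex \<Rightarrow> 'a::real_normed_vector \<Rightarrow> 'a) \<Rightarrow> (nat \<Rightarrow> 'a) \<Rightarrow> 'a \<Rightarrow> bool" where
  "weakly_tendsto smul X x \<longleftrightarrow>
     (\<forall>\<phi>\<in>dual_space smul. (\<lambda>j. blinfun_apply \<phi> (X j)) \<longlonglongrightarrow> blinfun_apply \<phi> x)"

text \<open>
  A function from \<open>T\<close> to the space is represented by a total function on the reals; each
  notion below depends only on its values on \<open>T\<close>.
\<close>

definition sup_dist ::
    "(real \<Rightarrow> 'a::real_normed_vector) \<Rightarrow> (real \<Rightarrow> 'a) \<Rightarrow> real set \<Rightarrow> ennreal" where
  "sup_dist f g T = (SUP t\<in>T. ennreal (norm (f t - g t)))"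

definition variation :: "(real \<Rightarrow> 'a::real_normed_vector) \<Rightarrow> real set \<Rightarrow> ennreal" where
  "variation g T =
     (SUP (m, t) \<in> {(m :: nat, t :: nat \<Rightarrow> real). 1 \<le> m \<and> t ` {0..m} \<subseteq> T \<and> mono_on {0..m} t}.
        \<Sum>i=1..m. ennreal (norm (g (t i) - g (t (i - 1)))))"

definition BV :: "real set \<Rightarrow> (real \<Rightarrow> 'a::real_normed_vector) set" where
  "BV T = {g. variation g T < \<infinity>}"

definition eps_variation ::
    "real \<Rightarrow> (real \<Rightarrow> 'a::real_normed_vector) \<Rightarrow> real set \<Rightarrow> ennreal" where
  "eps_variation \<epsilon> f T =
     (INF g \<in> {g \<in> BV T. sup_dist f g T \<le> ennreal \<epsilon>}. variation g T)"

definition regulated_on :: "real set \<Rightarrow> (real \<Rightarrow> 'a::real_normed_vector) \<Rightarrow> bool" where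
  "regulated_on T f \<longleftrightarrow>
     (\<forall>\<tau>\<in>T. (\<forall>\<delta>>0. T \<inter> {\<tau> - \<delta><..<\<tau>} \<noteq> {}) \<longrightarrow>
        ((\<lambda>(s, t). norm (f s - f t)) \<longlongrightarrow> 0)
          ((at \<tau> within T \<inter> {..<\<tau>}) \<times>\<^sub>F (at \<tau> within T \<inter> {..<\<tau>})))
     \<and> (\<forall>\<tau>\<in>T. (\<forall>\<delta>>0. T \<inter> {\<tau><..<\<tau> + \<delta>} \<noteq> {}) \<longrightarrow>
        ((\<lambda>(s, t). norm (f s - f t)) \<longlongrightarrow> 0)
          ((at \<tau> within T \<inter> {\<tau><..}) \<times>\<^sub>F (at \<tau> within T \<inter> {\<tau><..})))"

end

theory Submission imports Defs "HOL-Library.Diagonal_Subsequence"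
begin

text \<open>
  Finiteness of the approximate variation says that \<open>f j\<close> is uniformly close to a function of
  bounded variation \<open>h\<close>, and the increments of \<open>h\<close> are bounded by those of the monotone function
  \<open>w t = variation h (T \<inter> {..t})\<close>. So for each error \<open>e > 0\<close> the increments of \<open>f j\<close> are controlled, up
  to \<open>e\<close>, by a monotone real function with values bounded independently of \<open>j\<close> (once \<open>j\<close> is
  large). By Helly's theorem (\<open>Helly_selection_monotone_family\<close>) these controls converge at all
  points along a common subsequence. Where the limit of the controls hardly changes between two
  points, neither does \<open>f j\<close> for large \<open>j\<close>; so convergence at countably many well chosen points,
  tested on a countable dense set of functionals, propagates to all points of \<open>T\<close> and all
  functionals. Reflexivity turns the limits of the values into a weak limit \<open>g t\<close>. This is
  \<open>weak_pointwise_selection\<close>.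

  The bound on the approximate variation of \<open>g\<close> comes from applying the same selection principle a
  second time. If \<open>c\<close> exceeds the upper limit of the approximate variations for \<open>\<epsilon>\<close>, then for large \<open>j\<close>
  there are approximants of \<open>f j\<close> within \<open>\<epsilon>\<close> whose variation is at most \<open>c\<close>; a subsequence of them
  converges weakly at each point to some \<open>h'\<close>. The norm, and with it the variation, is lower
  semicontinuous for weak limits (\<open>sum_norm_le_weak_limit\<close>, \<open>variation_weak_limit_le\<close>), so \<open>h'\<close> has
  variation at most \<open>c\<close> and is within \<open>\<epsilon>\<close> of \<open>g\<close>. Semicontinuity with the exact constant rests on
  functionals of norm at most one that attain the norm of a given vector, that is, on the
  Hahn--Banach theorem (\<open>ex_norming_functional\<close>).

  Finally \<open>g\<close> itself has finite approximate variation for every \<open>\<epsilon>\<close>, so its increments are controlled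
  by bounded monotone functions up to arbitrarily small errors; bounded monotone functions are
  bounded and have one-sided limits, which makes \<open>g\<close> bounded and regulated.
\<close>

section \<open>A norming functional for every vector\<close>

definition sublinear :: "('a::real_vector \<Rightarrow> real) \<Rightarrow> bool" where
  "sublinear p \<longleftrightarrow> (\<forall>y z. p (y + z) \<le> p y + p z) \<and> (\<forall>r>0. \<forall>y. p (r *\<^sub>R y) \<le> r * p y)"

text \<open>
  Tilting by \<open>x\<close> is the elementary step that makes a sublinear functional smaller: it forces
  the value at \<open>- x\<close> down to at most \<open>- p x\<close>, which is the value it would have if \<open>p\<close> were
  linear along \<open>x\<close>. A sublinear functional that no tilt changes is therefore linear.
\<close>

definition tilt :: "('a::real_vector \<Rightarrow> real) \<Rightarrow> 'a \<Rightarrow> 'a \<Rightarrow> real" where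
  "tilt p x y = (INF t\<in>{0..}. p (y + t *\<^sub>R x) - t * p x)"

lemma sublinear_scale:
  assumes "sublinear p" "r > 0"
  shows "p (r *\<^sub>R y) = r * p y"
proof (rule antisym)
  show "p (r *\<^sub>R y) \<le> r * p y" using assms by (auto simp: sublinear_def)
  have "p ((1/r) *\<^sub>R (r *\<^sub>R y)) \<le> (1/r) * p (r *\<^sub>R y)"
    using assms unfolding sublinear_def by (metis zero_less_divide_1_iff)
  with assms(2) show "r * p y \<le> p (r *\<^sub>R y)" by (simp add: field_simps)
qed

lemma sublinear_zero: "sublinear p \<Longrightarrow> p 0 = 0"
  using sublinear_scale[of p 2 0] by simp

text \<open>
  The infimum is over a set bounded below by \<open>- p (- y)\<close>, by subadditivity applied to
  \<open>t *\<^sub>R x = (y + t *\<^sub>R x) + (- y)\<close>; only then is the real-valued infimum meaningful.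
\<close>

lemma tilt_le:
  assumes p: "sublinear p" and t: "0 \<le> t"
  shows "tilt p x y \<le> p (y + t *\<^sub>R x) - t * p x"
  unfolding tilt_def
proof (rule cINF_lower)
  have "- p (- y) \<le> p (y + s *\<^sub>R x) - s * p x" if "s \<ge> 0" for s
  proof -
    have "p (s *\<^sub>R x) = s * p x"
      using that sublinear_scale[OF p, of s x] sublinear_zero[OF p] by (cases "s = 0") auto
    moreover have "p (y + s *\<^sub>R x + - y) \<le> p (y + s *\<^sub>R x) + p (- y)"
      using p unfolding sublinear_def by blast
    ultimately show ?thesis by simp
  qed
  then show "bdd_below ((\<lambda>t. p (y + t *\<^sub>R x) - t * p x) ` {0..})"
    by (auto intro!: bdd_belowI2)
qed (use t in auto)

lemma tilt_greatest:
  "(\<And>t. 0 \<le> t \<Longrightarrow> c \<le> p (y + t *\<^sub>R x) - t * p x) \<Longrightarrow> c \<le> tilt p x y"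
  unfolding tilt_def by (rule cINF_greatest) auto

lemma sublinear_tilt:
  assumes p: "sublinear p"
  shows "sublinear (tilt p x)"
  unfolding sublinear_def
proof (intro conjI allI impI)
  fix y z
  have *: "tilt p x (y + z) \<le> (p (y + s *\<^sub>R x) - s * p x) + (p (z + t *\<^sub>R x) - t * p x)"
    if "0 \<le> s" "0 \<le> t" for s t
  proof -
    have "p ((y + s *\<^sub>R x) + (z + t *\<^sub>R x)) \<le> p (y + s *\<^sub>R x) + p (z + t *\<^sub>R x)"
      using p unfolding sublinear_def by blast
    moreover have "(y + s *\<^sub>R x) + (z + t *\<^sub>R x) = y + z + (s + t) *\<^sub>R x"
      by (simp add: algebra_simps)
    ultimately show ?thesis
      using tilt_le[OF p, of "s + t" x "y + z"] that by (simp add: algebra_simps)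
  qed
  have "tilt p x (y + z) - (p (y + s *\<^sub>R x) - s * p x) \<le> tilt p x z" if "0 \<le> s" for s
    by (rule tilt_greatest) (use *[OF that] in \<open>simp add: algebra_simps\<close>)
  then have "tilt p x (y + z) - tilt p x z \<le> tilt p x y"
    by (intro tilt_greatest) (simp add: algebra_simps)
  then show "tilt p x (y + z) \<le> tilt p x y + tilt p x z" by simp
next
  fix r :: real and y assume r: "r > 0"
  have "tilt p x (r *\<^sub>R y) / r \<le> tilt p x y"
  proof (rule tilt_greatest)
    fix t :: real assume t: "0 \<le> t"
    have "tilt p x (r *\<^sub>R y) \<le> p (r *\<^sub>R y + (r * t) *\<^sub>R x) - (r * t) * p x"
      by (rule tilt_le[OF p]) (use r t in simp)
    also have "p (r *\<^sub>R y + (r * t) *\<^sub>R x) = r * p (y + t *\<^sub>R x)"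
      using sublinear_scale[OF p r, of "y + t *\<^sub>R x"] by (simp add: algebra_simps)
    finally show "tilt p x (r *\<^sub>R y) / r \<le> p (y + t *\<^sub>R x) - t * p x"
      using r by (simp add: field_simps)
  qed
  then show "tilt p x (r *\<^sub>R y) \<le> r * tilt p x y" using r by (simp add: field_simps)
qed

text \<open>
  Subadditivity passes to the infimum because for two members of a chain the smaller one can
  serve in both summands.
\<close>

lemma sublinear_INF_chain:
  assumes C: "C \<noteq> {}" "\<And>p. p \<in> C \<Longrightarrow> sublinear p"
    and chain: "\<And>p q. p \<in> C \<Longrightarrow> q \<in> C \<Longrightarrow> p \<le> q \<or> q \<le> p"
    and bdd: "\<And>y. bdd_below ((\<lambda>p. p y) ` C)"
  shows "sublinear (\<lambda>y. INF p\<in>C. p y)"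
  unfolding sublinear_def
proof (intro conjI allI impI)
  fix y z
  have *: "(INF p\<in>C. p (y + z)) \<le> p y + q z" if pq: "p \<in> C" "q \<in> C" for p q
  proof -
    obtain m where m: "m \<in> C" "m \<le> p" "m \<le> q" using chain[OF pq] pq by auto
    have "(INF p\<in>C. p (y + z)) \<le> m (y + z)" by (rule cINF_lower[OF bdd m(1)])
    also have "\<dots> \<le> m y + m z" using C(2)[OF m(1)] by (auto simp: sublinear_def)
    also have "\<dots> \<le> p y + q z" using m by (intro add_mono) (auto simp: le_fun_def)
    finally show ?thesis .
  qed
  have "(INF p\<in>C. p (y + z)) - p y \<le> (INF q\<in>C. q z)" if "p \<in> C" for p
    by (rule cINF_greatest[OF C(1)]) (use *[OF that] in \<open>simp add: algebra_simps\<close>)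
  then have "(INF p\<in>C. p (y + z)) - (INF q\<in>C. q z) \<le> (INF p\<in>C. p y)"
    by (intro cINF_greatest[OF C(1)]) (simp add: algebra_simps)
  then show "(INF p\<in>C. p (y + z)) \<le> (INF p\<in>C. p y) + (INF p\<in>C. p z)" by simp
next
  fix r :: real and y assume r: "r > 0"
  have "(INF p\<in>C. p (r *\<^sub>R y)) / r \<le> (INF p\<in>C. p y)"
  proof (rule cINF_greatest[OF C(1)])
    fix p assume p: "p \<in> C"
    have "(INF p\<in>C. p (r *\<^sub>R y)) \<le> p (r *\<^sub>R y)" by (rule cINF_lower[OF bdd p])
    also have "\<dots> \<le> r * p y" using C(2)[OF p] r by (auto simp: sublinear_def)
    finally show "(INF p\<in>C. p (r *\<^sub>R y)) / r \<le> p y" using r by (simp add: field_simps)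
  qed
  then show "(INF p\<in>C. p (r *\<^sub>R y)) \<le> r * (INF p\<in>C. p y)" using r by (simp add: field_simps)
qed

text \<open>
  This instance of the Hahn--Banach theorem is proved within everywhere defined functionals. Among the
  sublinear functionals below the norm whose value at \<open>- x\<close> is at most \<open>- norm x\<close> (the tilt of
  the norm by \<open>x\<close> is one), Zorn's lemma gives a minimal one; tilts stay in the set, so minimality
  makes it invariant under all of them and hence linear.
\<close>

lemma ex_real_norming_functional:
  fixes x :: "'a::real_normed_vector"
  obtains u :: "'a \<Rightarrow> real"
  where "linear u" "\<And>y. \<bar>u y\<bar> \<le> norm y" "u x = norm x"
proof -
  define S where
    "S = {p :: 'a \<Rightarrow> real. sublinear p \<and> (\<forall>y. p y \<le> norm y) \<and> p (- x) \<le> - norm x}"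
  have norm: "sublinear (norm :: 'a \<Rightarrow> real)"
    by (auto simp: sublinear_def norm_triangle_ineq)
  have tilt_below: "tilt p z y \<le> p y" if "sublinear p" for p :: "'a \<Rightarrow> real" and y z
    using tilt_le[OF that, of 0 z y] by simp
  have tilt_neg: "tilt p z (- z) \<le> - p z" if "sublinear p" for p :: "'a \<Rightarrow> real" and z
    using tilt_le[OF that, of 1 z "- z"] sublinear_zero[OF that] by simp
  have start: "tilt norm x \<in> S"
    unfolding S_def using sublinear_tilt[OF norm] tilt_below[OF norm] tilt_neg[OF norm] by auto
  have lower: "- norm y \<le> p y" if "p \<in> S" for p y
  proof -
    have "p (y + - y) \<le> p y + p (- y)" "p (- y) \<le> norm (- y)" "p 0 = 0"
      using that sublinear_zero[of p] unfolding S_def sublinear_def by blast+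
    then show ?thesis by simp
  qed
  have "\<exists>m\<in>S. \<forall>p\<in>S. p \<le> m \<longrightarrow> p = m"
  proof (rule predicate_Zorn)
    show "partial_order_on S (relation_of (\<lambda>a b. b \<le> a) S)"
      by (rule partial_order_on_relation_ofI) auto
    fix C assume C: "C \<in> Chains (relation_of (\<lambda>a b. b \<le> a) S)"
    then have CS: "C \<subseteq> S" and chain: "\<And>p q. p \<in> C \<Longrightarrow> q \<in> C \<Longrightarrow> p \<le> q \<or> q \<le> p"
      by (auto simp: Chains_def relation_of_def)
    show "\<exists>u\<in>S. \<forall>p\<in>C. u \<le> p"
    proof (cases "C = {}")
      case True
      then show ?thesis using start by auto
    next
      case False
      have bdd: "bdd_below ((\<lambda>p. p y) ` C)" for y
        using lower CS by (intro bdd_belowI2[of _ "- norm y"]) auto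
      let ?u = "\<lambda>y. INF p\<in>C. p y"
      have le: "?u y \<le> p y" if "p \<in> C" for p y by (rule cINF_lower[OF bdd that])
      obtain p where p: "p \<in> C" using False by auto
      have "sublinear ?u"
        by (rule sublinear_INF_chain[OF False _ chain bdd]) (use CS in \<open>auto simp: S_def\<close>)
      moreover have "?u y \<le> norm y" for y
        using order_trans[OF le[OF p, of y]] p CS by (auto simp: S_def)
      moreover have "?u (- x) \<le> - norm x"
        using order_trans[OF le[OF p, of "- x"]] p CS by (auto simp: S_def)
      ultimately have "?u \<in> S" by (simp add: S_def)
      then show ?thesis using le by (intro bexI[of _ ?u]) (auto simp: le_fun_def)
    qed
  qed
  then obtain m where m: "m \<in> S" and least: "\<And>p. p \<in> S \<Longrightarrow> p \<le> m \<Longrightarrow> p = m" by blast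
  have sub: "sublinear m" using m by (simp add: S_def)
  have "tilt m z = m" for z
  proof (rule least)
    show "tilt m z \<le> m" using tilt_below[OF sub] by (simp add: le_fun_def)
    show "tilt m z \<in> S"
      using m sublinear_tilt[OF sub] order_trans[OF tilt_below[OF sub]] unfolding S_def
      by blast
  qed
  then have neg_le: "m (- z) \<le> - m z" for z using tilt_neg[OF sub, of z] by simp
  have add_le: "m (y + z) \<le> m y + m z" for y z using sub by (auto simp: sublinear_def)
  have odd: "m (- z) = - m z" for z
    using neg_le[of z] add_le[of z "- z"] sublinear_zero[OF sub] by simp
  have "linear m"
  proof (rule linearI)
    fix y z
    show "m (y + z) = m y + m z"
      using add_le[of y z] add_le[of "- y" "- z"] odd[of "y + z"] odd[of y] odd[of z] by simp
  next
    fix r :: real and y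
    consider "r = 0" | "r > 0" | "r < 0" by linarith
    then show "m (r *\<^sub>R y) = r *\<^sub>R m y"
    proof cases
      case 3
      then show ?thesis using sublinear_scale[OF sub, of "- r" y] odd[of "r *\<^sub>R y"] by simp
    qed (use sublinear_zero[OF sub] sublinear_scale[OF sub] in auto)
  qed
  moreover have "\<bar>m y\<bar> \<le> norm y" for y
    using lower[OF m, of y] m by (simp add: S_def abs_le_iff)
  moreover have "m x = norm x"
    using m odd[of x] by (simp add: S_def antisym)
  ultimately show ?thesis by (rule that)
qed

text \<open>
  Over the complex numbers the real functional \<open>u\<close> is the real part of the functional
  \<open>y \<mapsto> u y - \<i> * u (\<i> y)\<close>. Rotating \<open>y\<close> by a scalar of modulus one so that the value becomes
  real shows that its norm is still at most one, and then its value at \<open>x\<close>, having real part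
  \<open>norm x\<close>, cannot have an imaginary part.
\<close>

lemma ex_norming_functional:
  fixes smul :: "'k::real_or_complex \<Rightarrow> 'a::real_normed_vector \<Rightarrow> 'a"
  assumes "normed_space_over smul"
  obtains \<phi> where "\<phi> \<in> dual_space smul" "norm \<phi> \<le> 1"
    "blinfun_apply \<phi> x = of_real (norm x)"
proof -
  note functional_found = that
  interpret normed_space_over smul by fact
  obtain u :: "'a \<Rightarrow> real" where u: "linear u" "\<And>y. \<bar>u y\<bar> \<le> norm y" "u x = norm x"
    using ex_real_norming_functional by blast
  have suffices: thesis
    if hom: "\<And>c y. \<Phi> (smul c y) = c * \<Phi> y" and add: "\<And>y z. \<Phi> (y + z) = \<Phi> y + \<Phi> z"
      and le: "\<And>y. norm (\<Phi> y) \<le> norm y" and eq: "\<Phi> x = of_real (norm x)" for \<Phi> :: "'a \<Rightarrow> 'k"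
  proof -
    have "bounded_linear \<Phi>"
      by (rule bounded_linear_intro[where K = 1])
        (use add le hom[of "of_real _"] in \<open>auto simp: smul_of_real scaleR_conv_of_real\<close>)
    then have ap: "blinfun_apply (Blinfun \<Phi>) = \<Phi>" by (rule bounded_linear_Blinfun_apply)
    show thesis
    proof (rule functional_found)
      show "Blinfun \<Phi> \<in> dual_space smul" by (simp add: dual_space_def ap hom)
      show "norm (Blinfun \<Phi>) \<le> 1" by (rule norm_blinfun_bound) (simp_all add: ap le)
    qed (simp add: ap eq)
  qed
  have u_add: "u (y + z) = u y + u z" and u_scale: "u (r *\<^sub>R y) = r * u y" for y z r
    using u(1) by (auto simp: linear_add linear_scale)
  have u_diff: "u (y - z) = u y - u z" for y z using u(1) by (rule linear_diff)
  show thesis using real_or_complex[where 'a = 'k]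
  proof (elim disjE exE conjE)
    fix h :: "'k \<Rightarrow> real"
    assume h: "bij h" "\<forall>x y. h (x + y) = h x + h y" "\<forall>x y. h (x * y) = h x * h y"
      "\<forall>r x. h (r *\<^sub>R x) = r *\<^sub>R h x" "\<forall>x. norm (h x) = norm x"
    have "h 1 * h 1 = h 1" "h 1 \<noteq> 0" using h(3,5) by (metis mult_1, metis norm_zero norm_one zero_neq_one)
    then have "h 1 = 1" by simp
    then have "h (of_real r) = r" for r using h(4) by (simp add: of_real_def)
    then have c: "c = of_real (h c)" for c using h(1) by (metis bij_def inj_eq)
    show thesis
    proof (rule suffices[where \<Phi> = "\<lambda>y. of_real (u y)"])
      fix c :: 'k and y
      have "smul c y = h c *\<^sub>R y" using smul_of_real c by metis
      then show "of_real (u (smul c y)) = c * (of_real (u y) :: 'k)"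
        using c by (simp add: u_scale) 
    qed (use u in \<open>auto simp: u_add\<close>)
  next
    fix h :: "'k \<Rightarrow> complex"
    assume h: "bij h" "\<forall>x y. h (x + y) = h x + h y" "\<forall>x y. h (x * y) = h x * h y"
      "\<forall>r x. h (r *\<^sub>R x) = r *\<^sub>R h x" "\<forall>x. norm (h x) = norm x"
    have "h 1 * h 1 = h 1" "h 1 \<noteq> 0" using h(3,5) by (metis mult_1, metis norm_zero norm_one zero_neq_one)
    then have h1: "h 1 = 1" by simp
    then have h_real: "h (of_real r) = of_real r" for r using h(4) by (simp add: of_real_def)
    define j where "j = inv h \<i>"
    have hj: "h j = \<i>" using h(1) by (simp add: j_def bij_def surj_f_inv_f)
    define \<Phi> where "\<Phi> y = inv h (Complex (u y) (- u (smul j y)))" for y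
    have h\<Phi>: "h (\<Phi> y) = Complex (u y) (- u (smul j y))" for y
      using h(1) by (simp add: \<Phi>_def bij_def surj_f_inv_f)
    have eqI: "a = b" if "h a = h b" for a b using h(1) that by (simp add: bij_def inj_eq)
    have hom: "\<Phi> (smul c y) = c * \<Phi> y" for c y
    proof (rule eqI)
      have "c = of_real (Re (h c)) + of_real (Im (h c)) * j"
        by (rule eqI) (simp add: h h_real hj complex_eq mult.commute)
      then obtain a b where c: "c = of_real a + of_real b * j" by blast
      have "j * j = of_real (- 1)" by (rule eqI) (simp only: h_real h(3) hj, simp)
      then have jj: "smul j (smul j y) = - y" for y
        by (metis scale_scale smul_of_real scaleR_minus1_left)
      have "smul c y = a *\<^sub>R y + b *\<^sub>R smul j y"
        unfolding c by (simp add: scale_left_distrib smul_of_real flip: scale_scale)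
      moreover have "smul j (smul c y) = a *\<^sub>R smul j y + b *\<^sub>R (- y)"
        unfolding calculation
        by (simp only: scale_right_distrib flip: smul_of_real jj) (simp add: scale_scale mult.commute)
      ultimately show "h (\<Phi> (smul c y)) = h (c * \<Phi> y)"
        unfolding h\<Phi> h(3)[rule_format] c
        using u_scale[of "-1" y]
        by (simp add: h h_real hj h\<Phi> u_add u_diff u_scale complex_eq_iff)
    qed
    have add: "\<Phi> (y + z) = \<Phi> y + \<Phi> z" for y z
      by (rule eqI) (simp add: h h\<Phi> u_add scale_right_distrib complex_eq_iff)
    have le: "norm (\<Phi> y) \<le> norm y" for y
    proof (cases "\<Phi> y = 0")
      case False
      \<comment> \<open>the rotation that makes the value at \<open>y\<close> real and nonnegative\<close>
      define c where "c = of_real (norm (\<Phi> y)) / \<Phi> y"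
      have nc: "norm c = 1" using False by (simp add: c_def norm_divide)
      have "\<Phi> (smul c y) = of_real (norm (\<Phi> y))" using False by (simp add: hom c_def)
      then have "of_real (norm (\<Phi> y)) = Complex (u (smul c y)) (- u (smul j (smul c y)))"
        using h\<Phi>[of "smul c y"] h_real by simp
      then have "norm (\<Phi> y) = u (smul c y)" by (simp add: complex_eq_iff)
      also have "\<dots> \<le> norm (smul c y)" using u(2)[of "smul c y"] by simp
      finally show ?thesis by (simp add: norm_smul nc)
    qed simp
    have "\<Phi> x = of_real (norm x)"
    proof (rule eqI)
      have "(cmod (h (\<Phi> x)))\<^sup>2 \<le> (norm x)\<^sup>2"
        using le[of x] h(5) by (intro power_mono) auto
      then have "(norm x)\<^sup>2 + (u (smul j x))\<^sup>2 \<le> (norm x)\<^sup>2"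
        unfolding h\<Phi> by (simp add: u(3) cmod_power2)
      then have "u (smul j x) = 0" by simp
      then show "h (\<Phi> x) = h (of_real (norm x))"
        unfolding h\<Phi> h_real by (simp add: u(3) complex_eq_iff)
    qed
    with hom add le show thesis by (rule suffices[where \<Phi> = \<Phi>])
  qed
qed

section \<open>Subsequences converging at countably many points, and Helly's theorem\<close>

text \<open>
  An additive bijection that preserves the norm is an isometry, so it carries the
  Bolzano--Weierstrass property from its target to its source. Applied to the identification of
  the scalar field with the reals or the complex numbers, this makes the scalars a proper and
  in particular complete metric space.
\<close>

lemma convergent_subsequence_transfer:
  fixes a :: "nat \<Rightarrow> 'a::real_normed_vector"
    and h :: "'a \<Rightarrow> 'b::{real_normed_vector, heine_borel}"
  assumes bdd: "bounded (range a)"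
    and h: "bij h" "\<forall>x y. h (x + y) = h x + h y" "\<forall>x. norm (h x) = norm x"
  shows "\<exists>l r. strict_mono r \<and> (a \<circ> r) \<longlonglongrightarrow> l"
proof -
  have "h (x - y) + h y = h x" for x y using h(2) by (metis diff_add_cancel)
  then have "h (x - y) = h x - h y" for x y by (metis add_diff_cancel_right')
  then have iso: "dist (h x) (h y) = dist x y" for x y using h(3) by (metis dist_norm)
  obtain B where "norm (a n) \<le> B" for n using bdd unfolding bounded_iff by blast
  then have "norm ((h \<circ> a) n) \<le> B" for n using h(3) by simp
  then have "bounded (range (h \<circ> a))" unfolding bounded_iff by blast
  then obtain l r where r: "strict_mono r" "(h \<circ> a \<circ> r) \<longlonglongrightarrow> l"
    using bounded_imp_convergent_subsequence by blast
  have "h (inv h l) = l" using h(1) by (simp add: bij_def surj_f_inv_f)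
  then have "dist ((a \<circ> r) n) (inv h l) = dist ((h \<circ> a \<circ> r) n) l" for n
    using iso[of "a (r n)" "inv h l"] by simp
  then have "(a \<circ> r) \<longlonglongrightarrow> inv h l" using r(2) unfolding tendsto_iff by simp
  with r(1) show ?thesis by blast
qed

instance real_or_complex \<subseteq> heine_borel
proof
  fix a :: "nat \<Rightarrow> 'a::real_or_complex"
  assume bdd: "bounded (range a)"
  show "\<exists>l r. strict_mono r \<and> (a \<circ> r) \<longlonglongrightarrow> l"
    using real_or_complex[where 'a = 'a]
    by (elim disjE exE conjE) (rule convergent_subsequence_transfer[OF bdd]; assumption)+
qed

lemma diagonal_convergent_subsequence:
  fixes a :: "'i \<Rightarrow> nat \<Rightarrow> 'b::heine_borel"
  assumes "countable I" and bdd: "\<And>i. i \<in> I \<Longrightarrow> bounded (range (a i))"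
  obtains r where "strict_mono r" "\<And>i. i \<in> I \<Longrightarrow> convergent (\<lambda>j. a i (r j))"
proof (cases "I = {}")
  case True
  then show ?thesis using that[of id] by (auto simp: strict_mono_def)
next
  case False
  let ?a = "\<lambda>n. a (from_nat_into I n)"
  interpret subseqs "\<lambda>n s. convergent (?a n \<circ> s)"
  proof
    fix n and s :: "nat \<Rightarrow> nat"
    have "bounded (range (?a n \<circ> s))"
      by (rule bounded_subset[OF bdd[OF from_nat_into[OF False]]]) auto
    then obtain l r where "strict_mono r" "(?a n \<circ> s \<circ> r) \<longlonglongrightarrow> l"
      using bounded_imp_convergent_subsequence by blast
    then show "\<exists>r'. strict_mono r' \<and> convergent (?a n \<circ> (s \<circ> r'))"
      by (auto simp: convergent_def o_assoc)
  qed
  have "convergent (?a n \<circ> (diagseq \<circ> ((+) (Suc n))))" for n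
    by (rule diagseq_holds) (auto simp: o_assoc intro: convergent_subseq_convergent)
  moreover have "?a n \<circ> (diagseq \<circ> ((+) (Suc n))) = (\<lambda>j. ?a n (diagseq (j + Suc n)))" for n
    by (simp add: fun_eq_iff add.commute)
  ultimately have "convergent (\<lambda>j. ?a n (diagseq (j + Suc n)))" for n by simp
  then have "convergent (\<lambda>j. ?a n (diagseq j))" for n
    unfolding convergent_def by (blast intro: LIMSEQ_offset)
  then have "convergent (\<lambda>j. a i (diagseq j))" if "i \<in> I" for i
    using from_nat_into_surj[OF assms(1) that] by auto
  then show ?thesis using that[OF subseq_diagseq] by blast
qed

text \<open>
  Helly's selection theorem for countably many sequences at once. A diagonal subsequence
  converges at the rationals; the limit there extends to a monotone function \<open>L k\<close>, and
  monotonicity squeezes the sequence to \<open>L k t\<close> wherever \<open>L k\<close> is continuous. Only countably many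
  pairs \<open>(k, t)\<close> are left, and a second diagonal subsequence deals with them.
\<close>

lemma Helly_selection_monotone_family:
  fixes w :: "nat \<Rightarrow> nat \<Rightarrow> real \<Rightarrow> real"
  assumes mono: "\<And>k j. mono (w k j)" and bdd: "\<And>k. \<exists>B. \<forall>j t. \<bar>w k j t\<bar> \<le> B"
  obtains r where "strict_mono r" "\<And>k t. convergent (\<lambda>j. w k (r j) t)"
proof -
  have bdd': "bounded (range (\<lambda>j. w k (s j) t))" for k s t
    using bdd[of k] by (auto simp: bounded_iff)
  have "countable (UNIV \<times> \<rat> :: (nat \<times> real) set)" by (simp add: countable_rat)
  then obtain p where p: "strict_mono p"
    and "\<And>i. i \<in> UNIV \<times> \<rat> \<Longrightarrow> convergent (\<lambda>j. case i of (k, q) \<Rightarrow> w k (p j) q)"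
    by (rule diagonal_convergent_subsequence[where a = "\<lambda>(k, q) j. w k j q"])
      (use bdd'[of _ id] in auto)
  then have conv: "convergent (\<lambda>j. w k (p j) q)" if "q \<in> \<rat>" for k q using that by fastforce
  define val where "val k q = lim (\<lambda>j. w k (p j) q)" for k q
  have lim: "(\<lambda>j. w k (p j) q) \<longlonglongrightarrow> val k q" if "q \<in> \<rat>" for k q
    using conv[OF that] by (simp add: val_def convergent_LIMSEQ_iff)
  \<comment> \<open>a monotone extension to the line of the limits at rational points\<close>
  define L where "L k t = (SUP q\<in>{q\<in>\<rat>. q \<le> t}. val k q)" for k t
  have bdd_val: "bdd_above (val k ` {q\<in>\<rat>. q \<le> t})" for k t
  proof -
    obtain B where B: "\<forall>j t. \<bar>w k j t\<bar> \<le> B" using bdd by blast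
    have "val k q \<le> B" if "q \<in> \<rat>" for q
      by (rule LIMSEQ_le_const2[OF lim[OF that]]) (use B abs_le_D1 in blast)
    then show ?thesis by (intro bdd_aboveI2[of _ _ B]) auto
  qed
  have rat: "\<exists>q\<in>\<rat>. a < q \<and> q < b" if "a < b" for a b :: real
    using Rats_dense_in_real[OF that] by blast
  have ne: "{q\<in>\<rat>. q \<le> t} \<noteq> {}" for t :: real using rat[of "t - 1" t] by force
  have val_le: "val k q \<le> L k t" if "q \<in> \<rat>" "q \<le> t" for k q t
    unfolding L_def by (rule cSUP_upper[OF _ bdd_val]) (use that in auto)
  have le_val: "L k t \<le> val k q" if "q \<in> \<rat>" "t \<le> q" for k q t
    unfolding L_def
  proof (rule cSUP_least[OF ne])
    fix q' assume q': "q' \<in> {q \<in> \<rat>. q \<le> t}"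
    then show "val k q' \<le> val k q"
      using that by (intro LIMSEQ_le[OF lim lim]) (auto intro!: monoD[OF mono])
  qed
  have "mono (L k)" for k
    by (rule monoI, unfold L_def, rule cSUP_subset_mono) (use ne bdd_val in \<open>auto simp: L_def\<close>)
  then have countable: "countable (SIGMA k:UNIV. {t. \<not> isCont (L k) t})"
    by (intro countable_SIGMA mono_ctble_discont) auto
  have cont: "(\<lambda>j. w k (p j) t) \<longlonglongrightarrow> L k t" if "isCont (L k) t" for k t
  proof (rule order_tendstoI)
    fix a assume "a < L k t"
    with that have "eventually (\<lambda>y. a < L k y) (at t)"
      unfolding isCont_def by (rule order_tendstoD)
    then obtain d where d: "d > 0" "\<And>y. y \<noteq> t \<Longrightarrow> dist y t < d \<Longrightarrow> a < L k y"
      by (auto simp: eventually_at)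
    \<comment> \<open>the rational \<open>q\<close> separates \<open>t\<close> from a point where \<open>L k\<close> still exceeds \<open>a\<close>\<close>
    obtain q where q: "q \<in> \<rat>" "t - d/2 < q" "q < t" using rat[of "t - d/2" t] d(1) by auto
    have "a < L k (t - d/2)" using d by (auto simp: dist_real_def)
    also have "\<dots> \<le> val k q" by (rule le_val) (use q in auto)
    finally have "eventually (\<lambda>j. a < w k (p j) q) sequentially"
      by (rule order_tendstoD[OF lim[OF q(1)]])
    then show "eventually (\<lambda>j. a < w k (p j) t) sequentially"
      by eventually_elim (use monoD[OF mono, of q t] q(3) in \<open>auto intro: less_le_trans\<close>)
  next
    fix a assume "a > L k t"
    with that have "eventually (\<lambda>y. a > L k y) (at t)"
      unfolding isCont_def by (rule order_tendstoD)
    then obtain d where d: "d > 0" "\<And>y. y \<noteq> t \<Longrightarrow> dist y t < d \<Longrightarrow> L k y < a"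
      by (auto simp: eventually_at)
    obtain q where q: "q \<in> \<rat>" "t < q" "q < t + d/2" using rat[of t "t + d/2"] d(1) by auto
    have "val k q \<le> L k (t + d/2)" by (rule val_le) (use q in auto)
    also have "\<dots> < a" using d by (auto simp: dist_real_def)
    finally have "eventually (\<lambda>j. w k (p j) q < a) sequentially"
      by (rule order_tendstoD[OF lim[OF q(1)]])
    then show "eventually (\<lambda>j. w k (p j) t < a) sequentially"
      by eventually_elim (use monoD[OF mono, of t q] q(2) in \<open>auto intro: le_less_trans\<close>)
  qed
  obtain s where s: "strict_mono s"
    and "\<And>i. i \<in> (SIGMA k:UNIV. {t. \<not> isCont (L k) t}) \<Longrightarrow>
      convergent (\<lambda>j. case i of (k, t) \<Rightarrow> w k (p (s j)) t)"
    using countable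
    by (rule diagonal_convergent_subsequence[where a = "\<lambda>(k, t) j. w k (p j) t"])
      (use bdd'[of _ p] in auto)
  then have discont: "convergent (\<lambda>j. w k (p (s j)) t)" if "\<not> isCont (L k) t" for k t
    using that by fastforce
  have "convergent (\<lambda>j. w k ((p \<circ> s) j) t)" for k t
  proof (cases "isCont (L k) t")
    case True
    then show ?thesis
      using LIMSEQ_subseq_LIMSEQ[OF cont[OF True] s] by (auto simp: convergent_def o_def)
  qed (use discont in simp)
  then show ?thesis using that[OF strict_mono_o[OF p s]] by blast
qed

section \<open>Variation, approximate variation and monotone control of the oscillation\<close>

lemma variation_ge:
  fixes t :: "nat \<Rightarrow> real"
  assumes "1 \<le> m" "t ` {0..m} \<subseteq> T" "mono_on {0..m} t"
  shows "(\<Sum>i=1..m. ennreal (norm (g (t i) - g (t (i - 1))))) \<le> variation g T"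
  unfolding variation_def by (rule SUP_upper2[where i = "(m, t)"]) (use assms in auto)

lemma variation_le:
  assumes "\<And>(m :: nat) t. 1 \<le> m \<Longrightarrow> t ` {0..m} \<subseteq> T \<Longrightarrow> mono_on {0..m} t \<Longrightarrow>
    (\<Sum>i=1..m. ennreal (norm (g (t i) - g (t (i - 1))))) \<le> c"
  shows "variation g T \<le> c"
  unfolding variation_def
  by (rule SUP_least) (use assms in auto)

lemma variation_mono: "S \<subseteq> T \<Longrightarrow> variation g S \<le> variation g T"
  by (rule variation_le) (rule variation_ge, auto)

text \<open>
  Every partition of \<open>T \<inter> {..s}\<close> becomes one of \<open>T \<inter> {..t}\<close> by appending \<open>s\<close> and \<open>t\<close>, which adds at
  least the increment from \<open>s\<close> to \<open>t\<close>.
\<close>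

lemma variation_increment:
  assumes "s \<in> T" "t \<in> T" "s \<le> t"
  shows "variation g (T \<inter> {..s}) + ennreal (norm (g t - g s)) \<le> variation g (T \<inter> {..t})"
proof -
  have "variation g (T \<inter> {..s}) \<le> variation g (T \<inter> {..t}) - ennreal (norm (g t - g s))"
  proof (rule variation_le)
    fix m and p :: "nat \<Rightarrow> real"
    assume m: "1 \<le> m" and p: "p ` {0..m} \<subseteq> T \<inter> {..s}" and mono: "mono_on {0..m} p"
    \<comment> \<open>the partition \<open>p\<close> extended by \<open>s\<close> and then \<open>t\<close>\<close>
    define q where "q i = (if i \<le> m then p i else if i = Suc m then s else t)" for i
    let ?v = "\<lambda>q i. ennreal (norm (g (q i) - g (q (i - 1))))"
    have p_le: "p i \<le> s" if "i \<le> m" for i using p that by (auto simp: image_subset_iff)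
    have "q ` {0..m + 2} \<subseteq> T \<inter> {..t}"
      using p assms p_le by (auto simp: q_def intro: order_trans)
    moreover have "mono_on {0..m + 2} q"
    proof (rule mono_onI)
      fix i k assume "i \<in> {0..m + 2}" "k \<in> {0..m + 2}" "i \<le> k"
      then show "q i \<le> q k"
        using mono_onD[OF mono, of i k] p_le[of i] assms(3) by (auto simp: q_def intro: order_trans)
    qed
    ultimately have "(\<Sum>i=1..m + 2. ?v q i) \<le> variation g (T \<inter> {..t})"
      by (intro variation_ge) auto
    moreover have "(\<Sum>i=1..m + 2. ?v q i) =
        (\<Sum>i=1..m. ?v q i) + ?v q (Suc m) + ?v q (Suc (Suc m))"
      by simp
    moreover have "(\<Sum>i=1..m. ?v q i) = (\<Sum>i=1..m. ?v p i)"
      by (rule sum.cong) (auto simp: q_def)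
    moreover have "?v q (Suc (Suc m)) = ennreal (norm (g t - g s))" by (simp add: q_def)
    moreover have "(\<Sum>i=1..m. ?v p i) \<le> (\<Sum>i=1..m. ?v p i) + ?v q (Suc m)"
      by (rule add_increasing2) simp_all
    ultimately have "(\<Sum>i=1..m. ?v p i) + ennreal (norm (g t - g s)) \<le> variation g (T \<inter> {..t})"
      by (metis (no_types, lifting) add_right_mono order_trans)
    then show "(\<Sum>i=1..m. ?v p i) \<le> variation g (T \<inter> {..t}) - ennreal (norm (g t - g s))"
      unfolding ennreal_le_minus_iff by blast
  qed
  moreover have "ennreal (norm (g t - g s)) \<le> variation g (T \<inter> {..t})"
    using variation_ge[of 1 "\<lambda>i. if i = 0 then s else t" "T \<inter> {..t}" g] assms
    by (auto simp: mono_on_def image_subset_iff)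
  ultimately show ?thesis
    by (metis add_right_mono diff_add_cancel_ennreal)
qed

text \<open>
  Up to an error \<open>e\<close>, the increments of \<open>f\<close> are controlled by those of a monotone real function.
  This is what the proof uses of the approximate variation, both for extracting subsequences and
  for the regularity of the limit. The function \<open>w\<close> lives on the whole line, so that Helly's
  theorem and one-sided limits do not involve the shape of \<open>T\<close>.
\<close>

definition oscillation_within :: "real \<Rightarrow> (real \<Rightarrow> real) \<Rightarrow> (real \<Rightarrow> 'a::real_normed_vector) \<Rightarrow> real set \<Rightarrow> bool" where
  "oscillation_within e w f T \<longleftrightarrow>
     mono w \<and> (\<forall>s\<in>T. \<forall>t\<in>T. norm (f t - f s) \<le> e + \<bar>w t - w s\<bar>)"

text \<open>
  For a function of bounded variation the control is its variation up to \<open>t\<close>.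
\<close>

lemma oscillation_within_variation:
  assumes "variation g T \<le> ennreal c" "c \<ge> 0"
  obtains w where "oscillation_within 0 w g T" "\<And>t. \<bar>w t\<bar> \<le> c"
proof
  let ?V = "\<lambda>t. variation g (T \<inter> {..t})"
  define w where "w t = enn2real (?V t)" for t
  have le: "?V t \<le> ennreal c" for t
    using variation_mono[of "T \<inter> {..t}" T g] assms by auto
  then have fin: "?V t = ennreal (w t)" for t
    unfolding w_def by (metis ennreal_enn2real ennreal_less_top le_less_trans)
  have nonneg: "0 \<le> w t" for t by (simp add: w_def)
  show "\<bar>w t\<bar> \<le> c" for t using le[of t] fin[of t] nonneg[of t] assms(2) by simp
  have mono: "mono w"
  proof (rule monoI)
    fix s t :: real assume "s \<le> t"
    then have "?V s \<le> ?V t" by (intro variation_mono) auto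
    then show "w s \<le> w t" using nonneg by (simp add: fin)
  qed
  have incr: "norm (g t - g s) \<le> w t - w s" if "s \<in> T" "t \<in> T" "s \<le> t" for s t
    using variation_increment[OF that, of g] nonneg
    by (simp add: fin flip: ennreal_plus)
  have "norm (g t - g s) \<le> \<bar>w t - w s\<bar>" if "s \<in> T" "t \<in> T" for s t
    using incr[of s t] incr[of t s] that by (cases "s \<le> t") (auto simp: norm_minus_commute)
  with mono show "oscillation_within 0 w g T" by (simp add: oscillation_within_def)
qed

lemma sup_dist_le_iff:
  "\<epsilon> \<ge> 0 \<Longrightarrow> sup_dist f g T \<le> ennreal \<epsilon> \<longleftrightarrow> (\<forall>t\<in>T. norm (f t - g t) \<le> \<epsilon>)"
  by (simp add: sup_dist_def SUP_le_iff)

lemma eps_variation_lessE: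
  assumes "eps_variation \<epsilon> f T < ennreal c" "\<epsilon> \<ge> 0"
  obtains g where "variation g T \<le> ennreal c" "\<And>t. t \<in> T \<Longrightarrow> norm (f t - g t) \<le> \<epsilon>"
  using assms unfolding eps_variation_def INF_less_iff
  by (auto simp: sup_dist_le_iff intro: less_imp_le)

lemma eps_variation_le:
  assumes "variation g T \<le> ennreal c" "\<And>t. t \<in> T \<Longrightarrow> norm (f t - g t) \<le> \<epsilon>" "\<epsilon> \<ge> 0"
  shows "eps_variation \<epsilon> f T \<le> ennreal c"
  unfolding eps_variation_def
  by (rule INF_lower2[of g])
    (use assms in \<open>auto simp: sup_dist_le_iff BV_def intro: le_less_trans[OF _ ennreal_less_top]\<close>)

text \<open>
  An approximant within \<open>e / 2\<close> costs an error \<open>e / 2\<close> at each of the two end points of an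
  increment.
\<close>

lemma oscillation_within_eps_variation:
  assumes "eps_variation (e / 2) f T < ennreal c" "e \<ge> 0" "c \<ge> 0"
  obtains w where "oscillation_within e w f T" "\<And>t. \<bar>w t\<bar> \<le> c"
proof -
  obtain g where g: "variation g T \<le> ennreal c" "\<And>t. t \<in> T \<Longrightarrow> norm (f t - g t) \<le> e / 2"
    using eps_variation_lessE[OF assms(1)] assms(2) by auto
  obtain w where w: "oscillation_within 0 w g T" "\<And>t. \<bar>w t\<bar> \<le> c"
    using oscillation_within_variation[OF g(1) assms(3)] by blast
  have "norm (f t - f s) \<le> e + \<bar>w t - w s\<bar>" if "s \<in> T" "t \<in> T" for s t
  proof -
    have "norm (f t - f s) = norm ((f t - g t) + (g t - g s) - (f s - g s))" by simp
    also have "\<dots> \<le> norm (f t - g t) + norm (g t - g s) + norm (f s - g s)"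
      by (meson norm_triangle_ineq norm_triangle_ineq4 add_right_mono order_trans)
    finally show ?thesis
      using g(2)[of s] g(2)[of t] w(1) that by (force simp: oscillation_within_def)
  qed
  with w have "oscillation_within e w f T" by (simp add: oscillation_within_def)
  with w(2) that show thesis by blast
qed

lemma bounded_if_oscillation_within:
  assumes "oscillation_within e w f T" "\<And>t. \<bar>w t\<bar> \<le> c"
  shows "bounded (f ` T)"
proof (cases "T = {}")
  case False
  then obtain s where s: "s \<in> T" by blast
  have "norm (f t) \<le> norm (f s) + (e + 2 * c)" if "t \<in> T" for t
  proof -
    have "norm (f t - f s) \<le> e + \<bar>w t - w s\<bar>"
      using assms(1) s that by (auto simp: oscillation_within_def)
    moreover have "\<bar>w t - w s\<bar> \<le> 2 * c" using assms(2)[of s] assms(2)[of t] by linarith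
    ultimately show ?thesis using norm_triangle_sub[of "f t" "f s"] by linarith
  qed
  then show ?thesis unfolding bounded_iff by blast
qed simp

text \<open>
  A bounded monotone function comes arbitrarily close to its supremum to the left of \<open>\<tau>\<close> and stays
  there; this is the Cauchy condition for the left limit.
\<close>

lemma mono_bounded_oscillation_left:
  fixes w :: "real \<Rightarrow> real"
  assumes "mono w" "\<And>t. \<bar>w t\<bar> \<le> c" "e > 0"
  obtains a where "a < \<tau>" "\<And>s t. a < s \<Longrightarrow> s < \<tau> \<Longrightarrow> a < t \<Longrightarrow> t < \<tau> \<Longrightarrow> \<bar>w t - w s\<bar> < e"
proof -
  have bdd: "bdd_above (w ` {..<\<tau>})"
    using assms(2) by (intro bdd_aboveI2[of _ _ c]) (auto dest: abs_le_D1)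
  have "(SUP t\<in>{..<\<tau>}. w t) - e < (SUP t\<in>{..<\<tau>}. w t)" using assms(3) by simp
  then obtain a where a: "a < \<tau>" "(SUP t\<in>{..<\<tau>}. w t) - e < w a"
    using less_cSUP_iff[OF _ bdd] by (auto simp: lessThan_empty_iff)
  have "w a \<le> w s" "w s \<le> (SUP t\<in>{..<\<tau>}. w t)" if "a < s" "s < \<tau>" for s
    using that assms(1) bdd by (auto intro!: monoD[OF assms(1)] cSUP_upper)
  with a that show thesis by (smt (verit))
qed

lemma mono_bounded_oscillation_right:
  fixes w :: "real \<Rightarrow> real"
  assumes "mono w" "\<And>t. \<bar>w t\<bar> \<le> c" "e > 0"
  obtains b where "\<tau> < b" "\<And>s t. \<tau> < s \<Longrightarrow> s < b \<Longrightarrow> \<tau> < t \<Longrightarrow> t < b \<Longrightarrow> \<bar>w t - w s\<bar> < e"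
proof -
  have "mono (\<lambda>t. - w (- t))" using assms(1) by (auto simp: mono_def)
  moreover have "\<bar>- w (- t)\<bar> \<le> c" for t using assms(2) by simp
  ultimately obtain a where a: "a < - \<tau>"
    "\<And>s t. a < s \<Longrightarrow> s < - \<tau> \<Longrightarrow> a < t \<Longrightarrow> t < - \<tau> \<Longrightarrow> \<bar>- w (- t) - - w (- s)\<bar> < e"
    using mono_bounded_oscillation_left[of "\<lambda>t. - w (- t)" c e "- \<tau>"] assms(3) by blast
  show thesis
  proof
    show "\<tau> < - a" using a(1) by simp
    show "\<bar>w t - w s\<bar> < e" if "\<tau> < s" "s < - a" "\<tau> < t" "t < - a" for s t
      using a(2)[of "- s" "- t"] that by (simp add: abs_minus_commute)
  qed
qed

text \<open>
  The Cauchy condition at a one-sided limit holds for the monotone control, and the remaining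
  error \<open>e\<close> is arbitrary.
\<close>

lemma regulated_on_if_oscillation_within:
  fixes f :: "real \<Rightarrow> 'a::real_normed_vector"
  assumes "\<And>e. e > 0 \<Longrightarrow> \<exists>w c. oscillation_within e w f T \<and> (\<forall>t. \<bar>w t\<bar> \<le> c)"
  shows "regulated_on T f"
proof -
  have tendsto: "((\<lambda>(s, t). norm (f s - f t)) \<longlongrightarrow> 0) (F \<times>\<^sub>F F)"
    if F: "\<And>(w :: real \<Rightarrow> real) c e. mono w \<Longrightarrow> (\<And>t. \<bar>w t\<bar> \<le> c) \<Longrightarrow> e > 0 \<Longrightarrow>
      \<exists>A. eventually (\<lambda>t. t \<in> A) F \<and> (\<forall>s\<in>A. \<forall>t\<in>A. \<bar>w t - w s\<bar> < e)"
      and T: "eventually (\<lambda>t. t \<in> T) F"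
    for F :: "real filter"
  proof (rule tendstoI)
    fix e :: real assume "e > 0"
    then obtain w c where w: "oscillation_within (e / 2) w f T" "\<forall>t. \<bar>w t\<bar> \<le> c"
      using assms[of "e / 2"] by auto
    then obtain A where A: "eventually (\<lambda>t. t \<in> A) F" "\<forall>s\<in>A. \<forall>t\<in>A. \<bar>w t - w s\<bar> < e / 2"
      using F[of w c "e / 2"] \<open>e > 0\<close> by (auto simp: oscillation_within_def)
    have close: "norm (f s - f t) < e" if "s \<in> A \<and> s \<in> T" "t \<in> A \<and> t \<in> T" for s t
    proof -
      have "norm (f s - f t) \<le> e / 2 + \<bar>w s - w t\<bar>" "\<bar>w s - w t\<bar> < e / 2"
        using w A that by (auto simp: oscillation_within_def)
      then show ?thesis by linarith
    qed
    have "eventually (\<lambda>t. t \<in> A \<and> t \<in> T) F" using A(1) T by (rule eventually_conj)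
    then show "eventually (\<lambda>x. dist (case x of (s, t) \<Rightarrow> norm (f s - f t)) 0 < e) (F \<times>\<^sub>F F)"
      unfolding eventually_prod_same
      by (intro exI[of _ "\<lambda>t. t \<in> A \<and> t \<in> T"]) (use close in auto)
  qed
  show ?thesis
    unfolding regulated_on_def
  proof (intro conjI ballI impI tendsto)
    fix \<tau> :: real and w :: "real \<Rightarrow> real" and c e :: real
    assume w: "mono w" "\<And>t. \<bar>w t\<bar> \<le> c" "e > 0"
    obtain a where a: "a < \<tau>" "\<And>s t. a < s \<Longrightarrow> s < \<tau> \<Longrightarrow> a < t \<Longrightarrow> t < \<tau> \<Longrightarrow> \<bar>w t - w s\<bar> < e"
      using mono_bounded_oscillation_left[OF w] by blast
    have "eventually (\<lambda>t. t \<in> {a<..<\<tau>}) (at \<tau> within T \<inter> {..<\<tau>})"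
      unfolding eventually_at_filter
      using order_tendstoD(1)[OF tendsto_ident_at[of \<tau> UNIV] a(1)]
      by (auto simp: eventually_at_filter elim: eventually_mono)
    then show "\<exists>A. eventually (\<lambda>t. t \<in> A) (at \<tau> within T \<inter> {..<\<tau>}) \<and>
        (\<forall>s\<in>A. \<forall>t\<in>A. \<bar>w t - w s\<bar> < e)"
      using a(2) by (intro exI[of _ "{a<..<\<tau>}"]) auto
    obtain b where b: "\<tau> < b" "\<And>s t. \<tau> < s \<Longrightarrow> s < b \<Longrightarrow> \<tau> < t \<Longrightarrow> t < b \<Longrightarrow> \<bar>w t - w s\<bar> < e"
      using mono_bounded_oscillation_right[OF w] by blast
    have "eventually (\<lambda>t. t \<in> {\<tau><..<b}) (at \<tau> within T \<inter> {\<tau><..})"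
      unfolding eventually_at_filter
      using order_tendstoD(2)[OF tendsto_ident_at[of \<tau> UNIV] b(1)]
      by (auto simp: eventually_at_filter elim: eventually_mono)
    then show "\<exists>A. eventually (\<lambda>t. t \<in> A) (at \<tau> within T \<inter> {\<tau><..}) \<and>
        (\<forall>s\<in>A. \<forall>t\<in>A. \<bar>w t - w s\<bar> < e)"
      using b(2) by (intro exI[of _ "{\<tau><..<b}"]) auto
  qed (auto simp: eventually_at_filter)
qed

section \<open>Weak limits\<close>

lemma dual_space_add: "\<phi> \<in> dual_space smul \<Longrightarrow> \<psi> \<in> dual_space smul \<Longrightarrow> \<phi> + \<psi> \<in> dual_space smul"
  by (simp add: dual_space_def blinfun.add_left distrib_left)

lemma weakly_tendsto_diff:
  "weakly_tendsto smul X x \<Longrightarrow> weakly_tendsto smul Y y \<Longrightarrow>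
    weakly_tendsto smul (\<lambda>j. X j - Y j) (x - y)"
  unfolding weakly_tendsto_def blinfun.diff_right by (auto intro: tendsto_diff)

lemma weakly_tendsto_subseq:
  "weakly_tendsto smul X x \<Longrightarrow> strict_mono r \<Longrightarrow> weakly_tendsto smul (\<lambda>j. X (r j)) x"
  unfolding weakly_tendsto_def using LIMSEQ_subseq_LIMSEQ by (fastforce simp: o_def)

text \<open>
  Weak lower semicontinuity of a finite sum of norms: each norm in the limit is attained by a
  functional of norm at most one, and the sum of these functionals is continuous along the
  sequence and bounded by the sum of the norms. The case of one summand is the weak lower
  semicontinuity of the norm.
\<close>

lemma sum_norm_le_weak_limit:
  fixes X :: "'i \<Rightarrow> nat \<Rightarrow> 'a::real_normed_vector"
  assumes "normed_space_over smul"
    and lim: "\<And>i. i \<in> I \<Longrightarrow> weakly_tendsto smul (X i) (x i)"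
    and le: "\<And>j. (\<Sum>i\<in>I. norm (X i j)) \<le> c"
  shows "(\<Sum>i\<in>I. norm (x i)) \<le> c"
proof -
  have "\<exists>\<phi>. \<phi> \<in> dual_space smul \<and> norm \<phi> \<le> 1 \<and> blinfun_apply \<phi> (x i) = of_real (norm (x i))" for i
    using ex_norming_functional[OF assms(1)] by metis
  then obtain \<phi> where \<phi>: "\<And>i. \<phi> i \<in> dual_space smul" "\<And>i. norm (\<phi> i) \<le> 1"
    "\<And>i. blinfun_apply (\<phi> i) (x i) = of_real (norm (x i))" by metis
  have "(\<lambda>j. norm (\<Sum>i\<in>I. blinfun_apply (\<phi> i) (X i j)))
      \<longlonglongrightarrow> norm (\<Sum>i\<in>I. blinfun_apply (\<phi> i) (x i))"
    using lim \<phi>(1) by (intro tendsto_norm tendsto_sum) (auto simp: weakly_tendsto_def)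
  also have "norm (\<Sum>i\<in>I. blinfun_apply (\<phi> i) (x i)) = (\<Sum>i\<in>I. norm (x i))"
    by (simp add: \<phi>(3) sum_nonneg flip: of_real_sum)
  finally show ?thesis
  proof (rule LIMSEQ_le_const2, intro exI[of _ 0] allI impI)
    fix j
    have "norm (\<Sum>i\<in>I. blinfun_apply (\<phi> i) (X i j)) \<le> (\<Sum>i\<in>I. norm (\<phi> i) * norm (X i j))"
      by (intro sum_norm_le norm_blinfun)
    also have "\<dots> \<le> (\<Sum>i\<in>I. norm (X i j))"
      by (intro sum_mono mult_left_le_one_le) (auto simp: \<phi>(2))
    finally show "norm (\<Sum>i\<in>I. blinfun_apply (\<phi> i) (X i j)) \<le> c" using le[of j] by linarith
  qed
qed

lemma variation_weak_limit_le:
  assumes "normed_space_over smul"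
    and lim: "\<And>t. t \<in> T \<Longrightarrow> weakly_tendsto smul (\<lambda>j. h j t) (g t)"
    and le: "\<And>j. variation (h j) T \<le> ennreal c" and "c \<ge> 0"
  shows "variation g T \<le> ennreal c"
proof (rule variation_le)
  fix m and t :: "nat \<Rightarrow> real"
  assume t: "1 \<le> m" "t ` {0..m} \<subseteq> T" "mono_on {0..m} t"
  have "(\<Sum>i=1..m. norm (g (t i) - g (t (i - 1)))) \<le> c"
  proof (rule sum_norm_le_weak_limit[OF assms(1)])
    fix i assume "i \<in> {1..m}"
    then show "weakly_tendsto smul (\<lambda>j. h j (t i) - h j (t (i - 1))) (g (t i) - g (t (i - 1)))"
      using t(2) by (intro weakly_tendsto_diff lim) auto
  next
    fix j
    have "(\<Sum>i=1..m. ennreal (norm (h j (t i) - h j (t (i - 1))))) \<le> ennreal c"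
      using variation_ge[OF t, of "h j"] le[of j] by (rule order_trans)
    then show "(\<Sum>i=1..m. norm (h j (t i) - h j (t (i - 1)))) \<le> c" using \<open>c \<ge> 0\<close> by simp
  qed
  then show "(\<Sum>i=1..m. ennreal (norm (g (t i) - g (t (i - 1))))) \<le> ennreal c"
    by (simp add: ennreal_leI)
qed

text \<open>
  The limits of the values of the functionals form a bounded functional on the dual, and
  reflexivity represents it by a vector.
\<close>

lemma reflexive_weak_limit:
  fixes smul :: "'k::real_or_complex \<Rightarrow> 'a::real_normed_vector \<Rightarrow> 'a" and X :: "nat \<Rightarrow> 'a::real_normed_vector"
  assumes "reflexive_space smul" and bdd: "bounded (range X)"
    and conv: "\<And>\<phi>. \<phi> \<in> dual_space smul \<Longrightarrow> convergent (\<lambda>j. blinfun_apply \<phi> (X j))"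
  obtains x where "weakly_tendsto smul X x"
proof -
  define F where "F \<phi> = lim (\<lambda>j. blinfun_apply \<phi> (X j))" for \<phi> :: "'a \<Rightarrow>\<^sub>L 'k"
  have lim: "(\<lambda>j. blinfun_apply \<phi> (X j)) \<longlonglongrightarrow> F \<phi>" if "\<phi> \<in> dual_space smul" for \<phi>
    using conv[OF that] by (simp add: F_def convergent_LIMSEQ_iff)
  obtain B where B: "\<And>j. norm (X j) \<le> B" using bdd unfolding bounded_iff by blast
  have "bidual_functional smul F"
    unfolding bidual_functional_def
  proof (intro conjI ballI allI exI[of _ B])
    fix \<phi> \<psi> assume "\<phi> \<in> dual_space smul" "\<psi> \<in> dual_space smul"
    then have "(\<lambda>j. blinfun_apply (\<phi> + \<psi>) (X j)) \<longlonglongrightarrow> F \<phi> + F \<psi>"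
      unfolding blinfun.add_left by (intro tendsto_add lim)
    then show "F (\<phi> + \<psi>) = F \<phi> + F \<psi>" unfolding F_def by (rule limI)
  next
    fix c \<phi> assume "\<phi> \<in> dual_space smul"
    then have "(\<lambda>j. blinfun_apply (blinfun_mult_right c o\<^sub>L \<phi>) (X j)) \<longlonglongrightarrow> c * F \<phi>"
      by (auto intro!: tendsto_mult lim)
    then show "F (blinfun_mult_right c o\<^sub>L \<phi>) = c * F \<phi>" unfolding F_def by (rule limI)
  next
    fix \<phi> assume \<phi>: "\<phi> \<in> dual_space smul"
    have "norm (blinfun_apply \<phi> (X j)) \<le> B * norm \<phi>" for j
      using norm_blinfun[of \<phi> "X j"] mult_left_mono[OF B[of j] norm_ge_zero[of \<phi>]]
      by (simp add: mult.commute)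
    then show "norm (F \<phi>) \<le> B * norm \<phi>"
      by (intro LIMSEQ_le_const2[OF tendsto_norm[OF lim[OF \<phi>]]]) auto
  qed
  then obtain x where "\<forall>\<phi>\<in>dual_space smul. F \<phi> = blinfun_apply \<phi> x"
    using assms(1) unfolding reflexive_space_def by blast
  with lim have "weakly_tendsto smul X x" by (auto simp: weakly_tendsto_def)
  then show thesis by (rule that)
qed

section \<open>Selecting a weakly convergent subsequence\<close>

lemma Cauchy_if_approximable:
  fixes X :: "nat \<Rightarrow> 'a::metric_space"
  assumes "\<And>e. e > 0 \<Longrightarrow> \<exists>Y. Cauchy Y \<and> (\<forall>\<^sub>F j in sequentially. dist (X j) (Y j) \<le> e)"
  shows "Cauchy X"
proof (rule metric_CauchyI)
  fix e :: real assume e: "e > 0"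
  then obtain Y where Y: "Cauchy Y" "\<forall>\<^sub>F j in sequentially. dist (X j) (Y j) \<le> e / 4"
    using assms[of "e / 4"] by auto
  obtain N where N: "\<And>j. j \<ge> N \<Longrightarrow> dist (X j) (Y j) \<le> e / 4"
    using Y(2) by (auto simp: eventually_sequentially)
  obtain M where M: "\<And>i j. i \<ge> M \<Longrightarrow> j \<ge> M \<Longrightarrow> dist (Y i) (Y j) < e / 4"
    using metric_CauchyD[OF Y(1), of "e / 4"] e by auto
  have "dist (X i) (X j) < e" if "i \<ge> max M N" "j \<ge> max M N" for i j
    using N[of i] N[of j] M[of i j] that e
      dist_triangle[of "X i" "X j" "Y i"] dist_triangle[of "Y i" "X j" "Y j"]
    by (auto simp: dist_commute)
  then show "\<exists>M. \<forall>m\<ge>M. \<forall>n\<ge>M. dist (X m) (X n) < e" by blast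
qed

text \<open>
  Choose preimages of a countable dense subset of the image. For a monotone \<open>N\<close> this replaces
  the set consisting of a dense sequence in \<open>T\<close> together with the discontinuities of \<open>N\<close>.
\<close>

lemma ex_countable_approximating_subset:
  fixes N :: "'i \<Rightarrow> real"
  obtains D where "countable D" "D \<subseteq> T" "\<And>t e. t \<in> T \<Longrightarrow> e > 0 \<Longrightarrow> \<exists>s\<in>D. \<bar>N t - N s\<bar> < e"
proof -
  obtain B where B: "countable B" "B \<subseteq> N ` T" "N ` T \<subseteq> closure B"
    using separable[of "N ` T"] by blast
  show thesis
  proof
    show "countable (inv_into T N ` B)" using B(1) by simp
    show "inv_into T N ` B \<subseteq> T" using B(2) by (auto intro: inv_into_into)
    fix t and e :: real assume "t \<in> T" "e > 0"
    then have "N t \<in> closure B" using B(3) by blast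
    then obtain b where b: "b \<in> B" "dist b (N t) < e"
      using \<open>e > 0\<close> unfolding closure_approachable by blast
    then have "N (inv_into T N b) = b" using B(2) by (auto intro: f_inv_into_f)
    with b show "\<exists>s\<in>inv_into T N ` B. \<bar>N t - N s\<bar> < e"
      by (intro bexI[of _ "inv_into T N b"]) (auto simp: dist_real_def abs_minus_commute)
  qed
qed

text \<open>
  The selection principle behind the theorem. For each error \<open>1 / (k + 1)\<close>, Helly's theorem makes
  the monotone controls converge everywhere to some \<open>N k\<close>. A countable set \<open>D k\<close> approximates all
  points of \<open>T\<close> as far as \<open>N k\<close> can tell, and by one more diagonal argument the values of
  countably many functionals (dense in the dual) converge at all points of these sets. At any
  other \<open>t\<close>, compare with a point \<open>s \<in> D k\<close> such that \<open>N k s\<close> is close to \<open>N k t\<close>: for large \<open>j\<close> the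
  increment of \<open>f j\<close> between \<open>s\<close> and \<open>t\<close> is small. So the values of every functional at every
  point form a Cauchy sequence, and reflexivity yields the weak limit.
\<close>

lemma weak_pointwise_selection:
  fixes smul :: "'k::real_or_complex \<Rightarrow> 'a::real_normed_vector \<Rightarrow> 'a"
    and f :: "nat \<Rightarrow> real \<Rightarrow> 'a"
  assumes refl: "reflexive_space smul"
    and sep: "separable_space (top_of_set (dual_space smul))"
    and bdd: "\<And>t. t \<in> T \<Longrightarrow> bounded (range (\<lambda>j. f j t))"
    and osc: "\<And>e. e > 0 \<Longrightarrow> \<exists>w c. (\<forall>j. mono (w j)) \<and> (\<forall>j t. \<bar>w j t\<bar> \<le> c)
      \<and> (\<forall>\<^sub>F j in sequentially. oscillation_within e (w j) (f j) T)"
  obtains r g where "strict_mono (r :: nat \<Rightarrow> nat)"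
    "\<And>t. t \<in> T \<Longrightarrow> weakly_tendsto smul (\<lambda>j. f (r j) t) (g t)"
proof -
  obtain C where C: "countable C" "C \<subseteq> dual_space smul" "dual_space smul \<subseteq> closure C"
    using sep unfolding separable_space_def
    by (auto simp: closure_of_subtopology Int_absorb1)
  have "\<forall>k. \<exists>w c. (\<forall>j. mono (w j)) \<and> (\<forall>j t. \<bar>w j t\<bar> \<le> c)
      \<and> (\<forall>\<^sub>F j in sequentially. oscillation_within (inverse (real (Suc k))) (w j) (f j) T)"
    using osc by simp
  then obtain W where W: "\<And>k j. mono (W k j)" "\<And>k. \<exists>c. \<forall>j t. \<bar>W k j t\<bar> \<le> c"
    "\<And>k. \<forall>\<^sub>F j in sequentially. oscillation_within (inverse (real (Suc k))) (W k j) (f j) T"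
    by metis
  obtain p where p: "strict_mono p" "\<And>k t. convergent (\<lambda>j. W k (p j) t)"
    using Helly_selection_monotone_family[of W, OF W(1,2)] by blast
  define N where "N k t = lim (\<lambda>j. W k (p j) t)" for k t
  have N: "(\<lambda>j. W k (p j) t) \<longlonglongrightarrow> N k t" for k t
    using p(2) by (simp add: N_def convergent_LIMSEQ_iff)
  have "\<forall>k. \<exists>D. countable D \<and> D \<subseteq> T \<and> (\<forall>t\<in>T. \<forall>e>0. \<exists>s\<in>D. \<bar>N k t - N k s\<bar> < e)"
  proof
    fix k
    obtain D where "countable D" "D \<subseteq> T" "\<And>t e. t \<in> T \<Longrightarrow> e > 0 \<Longrightarrow> \<exists>s\<in>D. \<bar>N k t - N k s\<bar> < e"
      using ex_countable_approximating_subset[of T "N k"] by blast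
    then show "\<exists>D. countable D \<and> D \<subseteq> T \<and> (\<forall>t\<in>T. \<forall>e>0. \<exists>s\<in>D. \<bar>N k t - N k s\<bar> < e)" by blast
  qed
  then obtain D where D: "\<And>k. countable (D k)" "\<And>k. D k \<subseteq> T"
    "\<And>k t e. t \<in> T \<Longrightarrow> e > 0 \<Longrightarrow> \<exists>s\<in>D k. \<bar>N k t - N k s\<bar> < e"
    by metis
  have count: "countable (C \<times> (\<Union>k. D k))" using C(1) D(1) by auto
  have bdd_val: "bounded (range (\<lambda>j. blinfun_apply (fst i) (f (p j) (snd i))))"
    if "i \<in> C \<times> (\<Union>k. D k)" for i
  proof -
    have "snd i \<in> T" using that by (auto dest: subsetD[OF D(2)])
    then have "bounded (blinfun_apply (fst i) ` range (\<lambda>j. f j (snd i)))"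
      by (intro bounded_linear_image bdd blinfun.bounded_linear_right)
    then show ?thesis by (rule bounded_subset) auto
  qed
  obtain q where q: "strict_mono q"
    and conv: "\<And>i. i \<in> C \<times> (\<Union>k. D k) \<Longrightarrow>
      convergent (\<lambda>j. blinfun_apply (fst i) (f (p (q j)) (snd i)))"
  proof (rule diagonal_convergent_subsequence[OF count bdd_val])
    fix q :: "nat \<Rightarrow> nat"
    assume "strict_mono q" "\<And>i. i \<in> C \<times> (\<Union>k. D k) \<Longrightarrow>
      convergent (\<lambda>j. blinfun_apply (fst i) (f (p (q j)) (snd i)))"
    then show ?thesis by (rule that)
  qed
  have q_conv: "convergent (\<lambda>j. blinfun_apply \<psi> (f (p (q j)) s))"
    if "\<psi> \<in> C" "s \<in> D k" for \<psi> s k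
    using conv[of "(\<psi>, s)"] that by auto
  define r where "r = p \<circ> q"
  have r: "strict_mono r" unfolding r_def by (rule strict_mono_o[OF p(1) q])
  have Cauchy_C: "Cauchy (\<lambda>j. blinfun_apply \<psi> (f (r j) t))" if \<psi>: "\<psi> \<in> C" and t: "t \<in> T" for \<psi> t
  proof (rule Cauchy_if_approximable)
    fix e :: real assume e: "e > 0"
    \<comment> \<open>the increment will be below \<open>2 * d\<close>; the \<open>+ 1\<close> covers \<open>\<psi> = 0\<close>\<close>
    define d where "d = e / (2 * (norm \<psi> + 1))"
    have d: "d > 0" using e by (simp add: d_def add_nonneg_pos)
    obtain k where k: "inverse (real (Suc k)) < d" using reals_Archimedean[OF d] by blast
    obtain s where s: "s \<in> D k" "\<bar>N k t - N k s\<bar> < d" using D(3)[OF t d] by blast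
    have "(\<lambda>j. \<bar>W k (r j) t - W k (r j) s\<bar>) \<longlonglongrightarrow> \<bar>N k t - N k s\<bar>"
      using LIMSEQ_subseq_LIMSEQ[OF N q] unfolding r_def o_def
      by (intro tendsto_rabs tendsto_diff)
    then have "\<forall>\<^sub>F j in sequentially. \<bar>W k (r j) t - W k (r j) s\<bar> < d"
      using s(2) by (rule order_tendstoD)
    moreover have "\<forall>\<^sub>F j in sequentially.
        oscillation_within (inverse (real (Suc k))) (W k (r j)) (f (r j)) T"
      using eventually_subseq[OF r W(3)] .
    ultimately have "\<forall>\<^sub>F j in sequentially.
        dist (blinfun_apply \<psi> (f (r j) t)) (blinfun_apply \<psi> (f (r j) s)) \<le> e"
    proof eventually_elim
      case (elim j)
      have "norm (f (r j) t - f (r j) s) \<le> inverse (real (Suc k)) + \<bar>W k (r j) t - W k (r j) s\<bar>"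
        using elim(2) t s(1) D(2)[of k] unfolding oscillation_within_def by blast
      then have le: "norm (f (r j) t - f (r j) s) \<le> 2 * d" using elim(1) k by linarith
      have "dist (blinfun_apply \<psi> (f (r j) t)) (blinfun_apply \<psi> (f (r j) s))
          \<le> norm \<psi> * norm (f (r j) t - f (r j) s)"
        unfolding dist_norm blinfun.diff_right[symmetric] by (rule norm_blinfun)
      also have "\<dots> \<le> (norm \<psi> + 1) * (2 * d)"
        using le by (intro mult_mono) auto
      also have "\<dots> = e"
        using norm_ge_zero[of \<psi>] by (simp add: d_def field_simps add_nonneg_eq_0_iff)
      finally show ?case .
    qed
    moreover have "Cauchy (\<lambda>j. blinfun_apply \<psi> (f (r j) s))"
      using q_conv[OF \<psi> s(1)] by (simp add: r_def convergent_Cauchy)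
    ultimately show "\<exists>Y. Cauchy Y \<and>
        (\<forall>\<^sub>F j in sequentially. dist (blinfun_apply \<psi> (f (r j) t)) (Y j) \<le> e)" by blast
  qed
  have Cauchy: "Cauchy (\<lambda>j. blinfun_apply \<phi> (f (r j) t))"
    if \<phi>: "\<phi> \<in> dual_space smul" and t: "t \<in> T" for \<phi> t
  proof (rule Cauchy_if_approximable)
    fix e :: real assume e: "e > 0"
    obtain K where K: "K > 0" "\<And>j. norm (f j t) \<le> K"
      using bdd[OF t] unfolding bounded_pos by blast
    obtain \<psi> where \<psi>: "\<psi> \<in> C" "dist \<psi> \<phi> < e / K"
      using C(3) \<phi> e K(1) unfolding closure_approachable by (meson closure_approachable divide_pos_pos subsetD)
    have "dist (blinfun_apply \<phi> (f (r j) t)) (blinfun_apply \<psi> (f (r j) t)) \<le> e" for j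
    proof -
      have "dist (blinfun_apply \<phi> (f (r j) t)) (blinfun_apply \<psi> (f (r j) t))
          \<le> norm (\<phi> - \<psi>) * norm (f (r j) t)"
        unfolding dist_norm blinfun.diff_left[symmetric] by (rule norm_blinfun)
      also have "\<dots> \<le> e / K * K"
        using \<psi>(2) K e by (intro mult_mono) (auto simp: dist_norm norm_minus_commute)
      finally show ?thesis using K(1) by simp
    qed
    then show "\<exists>Y. Cauchy Y \<and>
        (\<forall>\<^sub>F j in sequentially. dist (blinfun_apply \<phi> (f (r j) t)) (Y j) \<le> e)"
      using Cauchy_C[OF \<psi>(1) t] by (intro exI[of _ "\<lambda>j. blinfun_apply \<psi> (f (r j) t)"]) simp
  qed
  have "\<exists>x. weakly_tendsto smul (\<lambda>j. f (r j) t) x" if t: "t \<in> T" for t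
  proof -
    have "bounded (range (\<lambda>j. f (r j) t))" by (rule bounded_subset[OF bdd[OF t]]) auto
    then show ?thesis
      using reflexive_weak_limit[OF refl, of "\<lambda>j. f (r j) t"] Cauchy[OF _ t] Cauchy_convergent
      by blast
  qed
  then show thesis using that[OF r] by metis
qed

section \<open>The selection theorem\<close>

theorem theorem4p15:
  fixes T :: "real set"
    and smul :: "'k::real_or_complex \<Rightarrow> 'a::banach \<Rightarrow> 'a"
    and f :: "nat \<Rightarrow> real \<Rightarrow> 'a"
  assumes "T \<noteq> {}"
    and "normed_space_over smul"
    and "reflexive_space smul"
    and "separable_space (top_of_set (dual_space smul))"
    and "\<exists>t\<^sub>0\<in>T. \<exists>C\<^sub>0\<ge>0. \<forall>j. norm (f j t\<^sub>0) \<le> C\<^sub>0"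
    and "\<And>\<epsilon>. \<epsilon> > 0 \<Longrightarrow> limsup (\<lambda>j. eps_variation \<epsilon> (f j) T) < \<infinity>"
  shows "\<exists>r :: nat \<Rightarrow> nat. \<exists>g :: real \<Rightarrow> 'a.
           strict_mono r
           \<and> (\<forall>\<epsilon>>0. eps_variation \<epsilon> g T \<le> limsup (\<lambda>j. eps_variation \<epsilon> (f j) T))
           \<and> bounded (g ` T) \<and> regulated_on T g
           \<and> (\<forall>t\<in>T. weakly_tendsto smul (\<lambda>j. f (r j) t) (g t))"
proof -
  let ?v = "\<lambda>\<epsilon>. limsup (\<lambda>j. eps_variation \<epsilon> (f j) T)"
  have ex_real: "\<exists>c\<ge>0. ?v \<epsilon> < ennreal c" if \<epsilon>: "\<epsilon> > 0" for \<epsilon>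
  proof -
    obtain c where "c \<ge> 0" "?v \<epsilon> = ennreal c"
      using assms(6)[OF \<epsilon>] by (cases "?v \<epsilon>") auto
    then show ?thesis by (intro exI[of _ "c + 1"]) (simp add: ennreal_less_iff)
  qed
  have osc: "\<exists>w c. (\<forall>j. mono (w j)) \<and> (\<forall>j t. \<bar>w j t\<bar> \<le> c)
      \<and> (\<forall>\<^sub>F j in sequentially. oscillation_within e (w j) (f j) T)" if e: "e > 0" for e
  proof -
    obtain c where c: "c \<ge> 0" "?v (e / 2) < ennreal c" using ex_real[of "e / 2"] e by auto
    \<comment> \<open>for the indices whose approximate variation is too large, the zero function is a placeholder\<close>
    have "\<exists>w. mono w \<and> (\<forall>t. \<bar>w t\<bar> \<le> c) \<and>
        (eps_variation (e / 2) (f j) T < ennreal c \<longrightarrow> oscillation_within e w (f j) T)" for j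
    proof (cases "eps_variation (e / 2) (f j) T < ennreal c")
      case True
      then obtain w where "oscillation_within e w (f j) T" "\<And>t. \<bar>w t\<bar> \<le> c"
        using oscillation_within_eps_variation e c(1) by (metis less_imp_le)
      then show ?thesis by (auto simp: oscillation_within_def)
    qed (use c(1) in \<open>auto intro!: exI[of _ "\<lambda>_. 0"] monoI\<close>)
    then obtain w where w: "\<And>j. mono (w j)" "\<And>j t. \<bar>w j t\<bar> \<le> c"
      "\<And>j. eps_variation (e / 2) (f j) T < ennreal c \<Longrightarrow> oscillation_within e (w j) (f j) T"
      by metis
    have "\<forall>\<^sub>F j in sequentially. oscillation_within e (w j) (f j) T"
      using Limsup_lessD[OF c(2)] by eventually_elim (rule w(3))
    with w(1,2) show ?thesis by blast
  qed
  have bdd: "bounded (range (\<lambda>j. f j t))" if t: "t \<in> T" for t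
  proof -
    obtain t0 C0 where t0: "t0 \<in> T" "\<And>j. norm (f j t0) \<le> C0" using assms(5) by blast
    obtain w c where w: "\<And>j t. \<bar>w j t\<bar> \<le> c"
      "\<forall>\<^sub>F j in sequentially. oscillation_within 1 (w j) (f j) T"
      using osc[of 1] by auto
    have "\<forall>\<^sub>F j in sequentially. norm (f j t) \<le> C0 + (1 + 2 * c)"
      using w(2)
    proof eventually_elim
      case (elim j)
      have "norm (f j t - f j t0) \<le> 1 + \<bar>w j t - w j t0\<bar>"
        using elim t0(1) t by (auto simp: oscillation_within_def)
      then show ?case
        using w(1)[of j t] w(1)[of j t0] t0(2)[of j] norm_triangle_sub[of "f j t" "f j t0"]
        by linarith
    qed
    then show ?thesis by (rule BfunI[THEN Bseq_eq_bounded[THEN iffD1]])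
  qed
  obtain r g where r: "strict_mono r"
    and g: "\<And>t. t \<in> T \<Longrightarrow> weakly_tendsto smul (\<lambda>j. f (r j) t) (g t)"
    using weak_pointwise_selection[OF assms(3,4) bdd osc] by blast
  \<comment> \<open>the bound for the limit: select once more, now from approximants of almost optimal variation\<close>
  have le: "eps_variation \<epsilon> g T \<le> ennreal c"
    if \<epsilon>: "\<epsilon> > 0" and c: "c \<ge> 0" "?v \<epsilon> < ennreal c" for \<epsilon> c
  proof -
    have "\<forall>\<^sub>F j in sequentially. eps_variation \<epsilon> (f (r j)) T < ennreal c"
      using eventually_subseq[OF r Limsup_lessD[OF c(2)]] .
    then obtain m where m: "\<And>j. j \<ge> m \<Longrightarrow> eps_variation \<epsilon> (f (r j)) T < ennreal c"
      by (auto simp: eventually_sequentially)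
    \<comment> \<open>shifted so that an approximant exists for every index\<close>
    define q where "q j = r (j + m)" for j
    have q: "strict_mono q" using r by (simp add: q_def strict_mono_def)
    have "\<exists>h. variation h T \<le> ennreal c \<and> (\<forall>t\<in>T. norm (f (q j) t - h t) \<le> \<epsilon>)" for j
      using m[of "j + m"] \<epsilon> unfolding q_def by (metis eps_variation_lessE le_add2 less_imp_le)
    then obtain h where h: "\<And>j. variation (h j) T \<le> ennreal c"
      "\<And>j t. t \<in> T \<Longrightarrow> norm (f (q j) t - h j t) \<le> \<epsilon>" by metis
    have h_bdd: "bounded (range (\<lambda>j. h j t))" if t: "t \<in> T" for t
    proof -
      obtain K where K: "\<And>j. norm (f j t) \<le> K" using bdd[OF t] unfolding bounded_iff by blast
      have "norm (h j t) \<le> K + \<epsilon>" for j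
        using h(2)[OF t, of j] K[of "q j"] norm_triangle_sub[of "h j t" "f (q j) t"]
        by (simp add: norm_minus_commute)
      then show ?thesis unfolding bounded_iff by blast
    qed
    have "\<exists>w. oscillation_within 0 w (h j) T \<and> (\<forall>t. \<bar>w t\<bar> \<le> c)" for j
      using oscillation_within_variation[OF h(1) c(1)] by metis
    then obtain w where w: "\<And>j. oscillation_within 0 (w j) (h j) T" "\<And>j t. \<bar>w j t\<bar> \<le> c" by metis
    have h_osc: "\<exists>w c. (\<forall>j. mono (w j)) \<and> (\<forall>j t. \<bar>w j t\<bar> \<le> c)
      \<and> (\<forall>\<^sub>F j in sequentially. oscillation_within e (w j) (h j) T)" if "e > 0" for e
    proof (intro exI[of _ w] exI[of _ c] conjI allI always_eventually)
      fix j
      show "mono (w j)" using w(1) by (simp add: oscillation_within_def)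
      show "oscillation_within e (w j) (h j) T"
        using w(1)[of j] that by (fastforce simp: oscillation_within_def)
    qed (rule w(2))
    obtain s h' where s: "strict_mono s"
      and h': "\<And>t. t \<in> T \<Longrightarrow> weakly_tendsto smul (\<lambda>j. h (s j) t) (h' t)"
      using weak_pointwise_selection[OF assms(3,4) h_bdd h_osc] by blast
    show ?thesis
    proof (rule eps_variation_le)
      show "variation h' T \<le> ennreal c"
        by (rule variation_weak_limit_le[OF assms(2) h' h(1) c(1)])
      fix t assume t: "t \<in> T"
      have "strict_mono (\<lambda>j. s j + m)" using s by (simp add: strict_mono_def)
      then have "weakly_tendsto smul (\<lambda>j. f (q (s j)) t) (g t)"
        unfolding q_def by (rule weakly_tendsto_subseq[OF g[OF t]])
      then have lim: "weakly_tendsto smul (\<lambda>j. f (q (s j)) t - h (s j) t) (g t - h' t)"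
        by (rule weakly_tendsto_diff[OF _ h'[OF t]])
      have "(\<Sum>i\<in>{()}. norm (g t - h' t)) \<le> \<epsilon>"
        by (rule sum_norm_le_weak_limit[OF assms(2), where X = "\<lambda>_ j. f (q (s j)) t - h (s j) t"])
          (simp_all add: lim h(2)[OF t])
      then show "norm (g t - h' t) \<le> \<epsilon>" by simp
    qed (use \<epsilon> in simp)
  qed
  have eps: "eps_variation \<epsilon> g T \<le> ?v \<epsilon>" if "\<epsilon> > 0" for \<epsilon>
  proof (rule dense_ge)
    fix x assume x: "?v \<epsilon> < x"
    show "eps_variation \<epsilon> g T \<le> x"
      using le[OF that, of "enn2real x"] x by (cases "x = \<infinity>") (auto simp: less_top)
  qed
  have g_osc: "\<exists>w c. oscillation_within e w g T \<and> (\<forall>t. \<bar>w t\<bar> \<le> c)" if e: "e > 0" for e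
  proof -
    obtain c where c: "c \<ge> 0" "?v (e / 2) < ennreal c" using ex_real[of "e / 2"] e by auto
    then have "eps_variation (e / 2) g T < ennreal c" using eps[of "e / 2"] e by auto
    then show ?thesis
      by (rule oscillation_within_eps_variation[OF _ less_imp_le[OF e] c(1)]) blast
  qed
  obtain w c where "oscillation_within 1 w g T" "\<And>t. \<bar>w t\<bar> \<le> c" using g_osc[of 1] by auto
  then have "bounded (g ` T)" by (rule bounded_if_oscillation_within)
  moreover have "regulated_on T g" using g_osc by (rule regulated_on_if_oscillation_within)
  ultimately show ?thesis using r g eps by blast
qed

end
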